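(* Let $\mathcal{G}_u=(\mathcal{V},\mathcal{E})$ be a connected undirected graph on $n$ vertices with a nonempty set of leaders $\mathfrak{S}\subset\mathcal{V}$ and follower set $\mathcal{V}\setminus\mathfrak{S}\neq\emptyset$. Let $\mathcal{L}_{g,u}$ be the grounded Laplacian induced by $\mathfrak{S}$ and $\lambda_1(\mathcal{L}_{g,u})$ its smallest eigenvalue. For each follower $v_i$ let $\Gamma_i$ be the number of leaders adjacent to $v_i$, and let $\Gamma_{\min}$, $\Gamma_{\max}$ be the minimum and maximum of $\Gamma_i$ over all followers. Let $v_k\in\mathfrak{S}$ be any leader, with closeness centrality $\mathcal{C}(v_k)$, and let $x_{\min}$ be the smallest component of a non-negative eigenvector $\mathbf{x}$ of $\mathcal{L}_{g,u}$ corresponding to $\lambda_1(\mathcal{L}_{g,u})$, normalized so that its largest component equals $1$. Then $$\max\left\{\frac{1}{\mathcal{C}(v_k)},\ \Gamma_{\min},\ \frac{|\partial\mathfrak{S}|}{n-|\mathfrak{S}|}\,x_{\min}\right\}\le \lambda_1(\mathcal{L}_{g,u})\le \min_{\emptyset\neq X\subseteq\mathcal{V}\setminus\mathfrak{S}}\frac{|\partial X|}{|X|}\le\frac{|\partial\mathfrak{S}|}{n-|\mathfrak{S}|}\le\Gamma_{\max}.$$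
   Context: Graphs are finite, simple and unweighted. The Laplacian of an undirected graph is $\mathcal{L}=D-A$, where $A$ is the adjacency matrix and $D$ the diagonal matrix of degrees. The grounded Laplacian $\mathcal{L}_{g,u}$ induced by $\mathfrak{S}$ is the $(n-|\mathfrak{S}|)\times(n-|\mathfrak{S}|)$ matrix obtained from $\mathcal{L}$ by deleting the rows and columns corresponding to the vertices of $\mathfrak{S}$. For $X\subset\mathcal{V}$, the edge-boundary $\partial X$ is the set of edges with one endpoint in $X$ and the other in $\mathcal{V}\setminus X$. The closeness centrality $\mathcal{C}(v_k)$ is the sum over all vertices $v\in\mathcal{V}$ of the length of a shortest path between $v$ and $v_k$ in $\mathcal{G}_u$. *)

theory Defs
  imports
    "Graph_Theory.Graph_Theory"
    "Jordan_Normal_Form.DL_Submatrix"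
    "Jordan_Normal_Form.Spectral_Radius"
begin

text \<open>
  A finite simple undirected graph is a symmetric digraph satisfying the locale \<open>graph\<close> of
  \<open>Graph_Theory\<close>: each undirected edge is a pair of opposite arcs, and there are no loops or
  parallel arcs. The matrices below are indexed by the vertices themselves, so they are meant
  for graphs with vertex set \<open>{0..<n}\<close>.
\<close>

definition adjacency_matrix :: "(nat, 'b) pre_digraph \<Rightarrow> real mat" where
  "adjacency_matrix G =
     mat (card (verts G)) (card (verts G)) (\<lambda>(i, j). if i \<rightarrow>\<^bsub>G\<^esub> j then 1 else 0)"

text \<open>In a symmetric digraph without parallel arcs, the out-degree is the undirected degree.\<close>

definition degree_matrix :: "(nat, 'b) pre_digraph \<Rightarrow> real mat" where
  "degree_matrix G =
     mat (card (verts G)) (card (verts G))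
       (\<lambda>(i, j). if i = j then real (out_degree G i) else 0)"

definition laplacian :: "(nat, 'b) pre_digraph \<Rightarrow> real mat" where
  "laplacian G = degree_matrix G - adjacency_matrix G"

text \<open>\<open>submatrix A I J\<close> keeps the rows in \<open>I\<close> and the columns in \<open>J\<close>, in increasing order.\<close>

definition grounded_laplacian :: "(nat, 'b) pre_digraph \<Rightarrow> nat set \<Rightarrow> real mat" where
  "grounded_laplacian G S = submatrix (laplacian G) (verts G - S) (verts G - S)"

text \<open>
  Only real eigenvalues are considered; for a real symmetric matrix these are all eigenvalues.
\<close>

definition smallest_eigenvalue :: "real mat \<Rightarrow> real" where
  "smallest_eigenvalue A = Min (spectrum A)"

definition edge_boundary :: "('a, 'b) pre_digraph \<Rightarrow> 'a set \<Rightarrow> 'a set set" where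
  "edge_boundary G X = {{u, v} | u v. u \<in> X \<and> v \<in> verts G - X \<and> u \<rightarrow>\<^bsub>G\<^esub> v}"

text \<open>
  With unit weights, \<open>\<mu>\<close> is the least number of arcs of a walk between two vertices, which is
  the length of a shortest path. It is finite in a connected graph.
\<close>

definition closeness_centrality :: "('a, 'b) pre_digraph \<Rightarrow> 'a \<Rightarrow> real" where
  "closeness_centrality G w =
     (\<Sum>v\<in>verts G. real_of_ereal (wf_digraph.\<mu> G (\<lambda>_. 1) v w))"

definition leader_count :: "('a, 'b) pre_digraph \<Rightarrow> 'a set \<Rightarrow> 'a \<Rightarrow> nat" where
  "leader_count G S v = card {s \<in> S. v \<rightarrow>\<^bsub>G\<^esub> s}"

definition leader_count_min :: "('a, 'b) pre_digraph \<Rightarrow> 'a set \<Rightarrow> nat" where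
  "leader_count_min G S = Min (leader_count G S ` (verts G - S))"

definition leader_count_max :: "('a, 'b) pre_digraph \<Rightarrow> 'a set \<Rightarrow> nat" where
  "leader_count_max G S = Max (leader_count G S ` (verts G - S))"

definition normalized_nonneg_eigenvector :: "real mat \<Rightarrow> real \<Rightarrow> real vec \<Rightarrow> bool" where
  "normalized_nonneg_eigenvector A l x \<longleftrightarrow>
     eigenvector A x l \<and> (\<forall>a \<in> set\<^sub>v x. 0 \<le> a) \<and> Max (set\<^sub>v x) = 1"

end

theory Submission
  imports Defs "HOL-Analysis.Function_Topology"
begin

text \<open>
  Identify vectors indexed by the followers with functions on all vertices that vanish on the
  leaders. The quadratic form of the grounded Laplacian is then the Dirichlet energy, so
  \<open>\<lambda>\<^sub>1\<close> is the minimum of the Rayleigh quotient; passing from a minimizer to its absolute value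
  does not increase the energy, which gives a non-negative eigenvector. Indicator functions as
  test functions give the upper bound. Summing the eigenvalue equation over all followers gives
  \<open>\<lambda>\<^sub>1 \<Sum> x\<^sub>i = \<Sum> \<Gamma>\<^sub>i x\<^sub>i\<close>, hence the two lower bounds involving \<open>\<Gamma>_min\<close> and \<open>x_min\<close>. Finally, a
  function vanishing at \<open>k\<close> satisfies \<open>y(v)\<^sup>2 \<le> d(v, k) \<cdot> energy\<close> by Cauchy-Schwarz along a
  shortest path, and summing over \<open>v\<close> bounds the Rayleigh quotient below by the inverse
  closeness.
\<close>

text \<open>The first-order condition: a quadratic in \<open>t\<close> with minimum 0 at
  \<open>t = 0\<close> has no linear term. It will turn minimality of the energy into the eigenvalue
  equation.\<close>

lemma perturbation_coefficient_zero:
  fixes b c :: real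
  assumes "\<And>t. 0 \<le> 2 * t * b + t\<^sup>2 * c"
  shows "b = 0"
proof (rule ccontr)
  assume "b \<noteq> 0"
  \<comment> \<open>For this \<open>t\<close> the linear term is -2 t^2 (|c| + 1), which outweighs
    t^2 c whatever the sign of \<open>c\<close>.\<close>
  define t where "t = - b / (\<bar>c\<bar> + 1)"
  have b: "b = - (t * (\<bar>c\<bar> + 1))"
    by (simp add: t_def)
  have "t \<noteq> 0" using \<open>b \<noteq> 0\<close> by (simp add: t_def)
  have "2 * t * b + t\<^sup>2 * c = t\<^sup>2 * (c - 2 * (\<bar>c\<bar> + 1))"
    by (simp add: b power2_eq_square algebra_simps)
  moreover have "t\<^sup>2 * (c - 2 * (\<bar>c\<bar> + 1)) < 0"
    using \<open>t \<noteq> 0\<close> by (intro mult_pos_neg) auto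
  ultimately show False
    using assms[of t] by simp
qed

section \<open>Dirichlet energy on a weighted network\<close>

locale network =
  fixes V :: "'a set" and a :: "'a \<Rightarrow> 'a \<Rightarrow> real"
  assumes finite_V: "finite V"
    and weight_sym: "a u v = a v u"
    and weight_nonneg: "0 \<le> a u v"
begin

definition lap :: "('a \<Rightarrow> real) \<Rightarrow> 'a \<Rightarrow> real" where
  "lap y u = (\<Sum>v\<in>V. a u v * (y u - y v))"

definition energy :: "('a \<Rightarrow> real) \<Rightarrow> real" where
  "energy y = (\<Sum>u\<in>V. \<Sum>v\<in>V. a u v * (y u - y v)\<^sup>2) / 2"

text \<open>Eigenvectors of the grounded matrix become functions on all vertices with boundary value
  0. The sum in \<open>lap\<close> runs over all of \<open>V\<close>, so edges to the boundary stay
  in the diagonal.\<close>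

definition dirichlet_eigen :: "'a set \<Rightarrow> ('a \<Rightarrow> real) \<Rightarrow> real \<Rightarrow> bool" where
  "dirichlet_eigen F y l \<longleftrightarrow>
     (\<forall>u. u \<notin> F \<longrightarrow> y u = 0) \<and> (\<exists>u. y u \<noteq> 0) \<and> (\<forall>u\<in>F. lap y u = l * y u)"

lemma sum_symmetrize:
  assumes "finite W"
  shows "(\<Sum>u\<in>W. \<Sum>v\<in>W. a u v * f u v) = (\<Sum>u\<in>W. \<Sum>v\<in>W. a u v * (f u v + f v u)) / 2"
proof -
  have "(\<Sum>u\<in>W. \<Sum>v\<in>W. a u v * f v u) = (\<Sum>u\<in>W. \<Sum>v\<in>W. a u v * f u v)"
    by (subst sum.swap) (simp add: weight_sym)
  then show ?thesis
    by (simp add: algebra_simps sum.distrib)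
qed

text \<open>Green's identity: symmetrizing pairs the summands for (u, v) and (v, u), which combine
  to a product of differences.\<close>

lemma green:
  "(\<Sum>u\<in>V. z u * lap y u) = (\<Sum>u\<in>V. \<Sum>v\<in>V. a u v * ((y u - y v) * (z u - z v))) / 2"
proof -
  have "(\<Sum>u\<in>V. z u * lap y u) = (\<Sum>u\<in>V. \<Sum>v\<in>V. a u v * (z u * (y u - y v)))"
    by (simp add: lap_def sum_distrib_left mult.left_commute)
  also have "\<dots> = (\<Sum>u\<in>V. \<Sum>v\<in>V. a u v * (z u * (y u - y v) + z v * (y v - y u))) / 2"
    by (rule sum_symmetrize[OF finite_V])
  also have "\<dots> = (\<Sum>u\<in>V. \<Sum>v\<in>V. a u v * ((y u - y v) * (z u - z v))) / 2"
    by (simp add: algebra_simps)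
  finally show ?thesis .
qed

lemma energy_eq_sum_lap: "energy y = (\<Sum>u\<in>V. y u * lap y u)"
  unfolding energy_def green power2_eq_square ..

lemma energy_nonneg: "0 \<le> energy y"
  unfolding energy_def by (simp add: sum_nonneg weight_nonneg)

text \<open>The reverse triangle inequality, edge by edge. It yields a non-negative eigenvector
  without Perron-Frobenius theory.\<close>

lemma energy_abs_le: "energy (\<lambda>u. \<bar>y u\<bar>) \<le> energy y"
proof -
  have "(\<bar>s\<bar> - \<bar>t\<bar>)\<^sup>2 \<le> (s - t)\<^sup>2" for s t :: real
    by (metis abs_le_square_iff abs_triangle_ineq3)
  then show ?thesis
    unfolding energy_def
    by (intro divide_right_mono sum_mono mult_left_mono) (auto simp: weight_nonneg)
qed

text \<open>By \<open>green\<close>, the linear term is the first variation of the energy: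
  \<open>lap y\<close> paired with the direction \<open>z\<close>.\<close>

lemma energy_add_scaled:
  "energy (\<lambda>u. y u + t * z u) = energy y + 2 * t * (\<Sum>u\<in>V. z u * lap y u) + t\<^sup>2 * energy z"
proof -
  have "a u v * (y u + t * z u - (y v + t * z v))\<^sup>2
      = a u v * (y u - y v)\<^sup>2 + (2 * t) * (a u v * ((y u - y v) * (z u - z v)))
        + t\<^sup>2 * (a u v * (z u - z v)\<^sup>2)" for u v
    by (simp add: power2_eq_square algebra_simps)
  then show ?thesis
    unfolding energy_def green by (simp add: sum.distrib sum_distrib_left add_divide_distrib)
qed

lemma dirichlet_eigen_energy:
  assumes "dirichlet_eigen F y l"
  shows "energy y = l * (\<Sum>u\<in>V. (y u)\<^sup>2)"
  unfolding energy_eq_sum_lap sum_distrib_left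
proof (rule sum.cong)
  fix u
  show "y u * lap y u = l * (y u)\<^sup>2"
    using assms by (cases "u \<in> F") (auto simp: dirichlet_eigen_def power2_eq_square)
qed simp

lemma dirichlet_eigen_sum_squares_pos:
  assumes "dirichlet_eigen F y l" "F \<subseteq> V"
  shows "0 < (\<Sum>u\<in>V. (y u)\<^sup>2)"
proof -
  obtain u where "y u \<noteq> 0" "u \<in> V"
    using assms by (auto simp: dirichlet_eigen_def)
  then show ?thesis
    by (intro sum_pos2[OF finite_V, of u]) auto
qed

lemma dirichlet_eigen_nonneg:
  assumes "dirichlet_eigen F y l" "F \<subseteq> V"
  shows "0 \<le> l"
  using dirichlet_eigen_energy[OF assms(1)] dirichlet_eigen_sum_squares_pos[OF assms]
    energy_nonneg[of y] by (simp add: zero_le_mult_iff)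

section \<open>Minimizing the Rayleigh quotient\<close>

text \<open>The continuous energy attains its minimum on the compact unit sphere of functions
  supported in \<open>F\<close>. The last conclusion is the Rayleigh bound in homogeneous form,
  without division by the norm of \<open>z\<close>.\<close>

lemma energy_minimizer_exists:
  assumes "F \<subseteq> V" "F \<noteq> {}"
  obtains y where "\<And>u. u \<notin> F \<Longrightarrow> y u = 0" "(\<Sum>u\<in>V. (y u)\<^sup>2) = 1"
    "\<And>z. (\<And>u. u \<notin> F \<Longrightarrow> z u = 0) \<Longrightarrow> energy y * (\<Sum>u\<in>V. (z u)\<^sup>2) \<le> energy z"
proof -
  \<comment> \<open>The index type may be infinite, so compactness comes from a product of compact
    sets; the factor {0} outside \<open>F\<close> encodes the support condition.\<close>
  define box where "box = PiE UNIV (\<lambda>u. if u \<in> F then {-1..1::real} else {0})"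
  define K where "K = {y. (\<Sum>u\<in>V. (y u)\<^sup>2) = 1} \<inter> box"
  have "compactin (product_topology (\<lambda>_. euclidean) UNIV) box"
    unfolding box_def by (subst compactin_PiE) auto
  then have "compact box"
    by (simp add: euclidean_product_topology)
  moreover have "closed {y::'a \<Rightarrow> real. (\<Sum>u\<in>V. (y u)\<^sup>2) = 1}"
    by (intro closed_Collect_eq continuous_on_sum continuous_on_power continuous_on_const
          continuous_on_product_coordinates)
  ultimately have "compact K"
    unfolding K_def by (rule closed_Int_compact[rotated])
  have inK: "y \<in> K" if supp: "\<And>u. u \<notin> F \<Longrightarrow> y u = 0" and nrm: "(\<Sum>u\<in>V. (y u)\<^sup>2) = 1" for y
  proof -
    have "\<bar>y u\<bar> \<le> 1" if "u \<in> F" for u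
    proof -
      have "(y u)\<^sup>2 \<le> (\<Sum>u\<in>V. (y u)\<^sup>2)"
        using that assms by (intro member_le_sum) (auto simp: finite_V)
      then show ?thesis
        by (simp add: nrm abs_square_le_1)
    qed
    then show ?thesis
      using supp nrm by (auto simp: K_def box_def abs_le_iff)
  qed
  obtain w where "w \<in> F" using assms by blast
  have "(\<lambda>u. if u = w then 1 else 0) \<in> K"
    using \<open>w \<in> F\<close> assms
    by (intro inK) (auto simp: finite_V if_distrib[of "\<lambda>x. x\<^sup>2"] cong: if_cong)
  then have "K \<noteq> {}"
    by blast
  moreover have "continuous_on K energy"
    unfolding energy_def
    by (intro continuous_on_divide continuous_on_sum continuous_on_mult continuous_on_power
          continuous_on_diff continuous_on_const continuous_on_subset[OF continuous_on_product_coordinates])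
       auto
  ultimately obtain y where y: "y \<in> K" "\<And>z. z \<in> K \<Longrightarrow> energy y \<le> energy z"
    using continuous_attains_inf[OF \<open>compact K\<close>] by blast
  show ?thesis
  proof (rule that[of y])
    show "y u = 0" if "u \<notin> F" for u
    proof -
      have "y u \<in> (if u \<in> F then {-1..1} else {0})"
        using y(1) unfolding K_def box_def by blast
      then show ?thesis using that by simp
    qed
    show "(\<Sum>u\<in>V. (y u)\<^sup>2) = 1"
      using y(1) by (simp add: K_def)
    fix z :: "'a \<Rightarrow> real"
    assume supp: "\<And>u. u \<notin> F \<Longrightarrow> z u = 0"
    define s where "s = (\<Sum>u\<in>V. (z u)\<^sup>2)"
    show "energy y * (\<Sum>u\<in>V. (z u)\<^sup>2) \<le> energy z"
    proof (cases "s = 0")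
      case True
      then show ?thesis by (simp add: s_def energy_nonneg)
    next
      case False
      then have "0 < s"
        by (simp add: s_def less_le sum_nonneg)
      have "(\<Sum>u\<in>V. (z u / sqrt s)\<^sup>2) = 1"
        using \<open>0 < s\<close> by (simp add: power_divide flip: sum_divide_distrib s_def)
      then have "energy y \<le> energy (\<lambda>u. z u / sqrt s)"
        using supp by (intro y(2) inK) auto
      also have "\<dots> = energy z / s"
        using \<open>0 < s\<close>
        by (simp add: energy_def power_divide mult.commute flip: diff_divide_distrib sum_divide_distrib)
      finally show ?thesis
        using \<open>0 < s\<close> by (simp add: s_def field_simps)
    qed
  qed
qed

text \<open>Since \<open>y\<close> attains equality in the bound \<open>min\<close>, perturbing it
  at a single vertex of \<open>F\<close> can only raise the gap between the two sides above
  0.\<close>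

lemma minimizer_is_dirichlet_eigen:
  assumes F: "F \<subseteq> V" and supp: "\<And>u. u \<notin> F \<Longrightarrow> y u = 0" and "\<exists>u. y u \<noteq> 0"
    and eq: "energy y = l * (\<Sum>u\<in>V. (y u)\<^sup>2)"
    and min: "\<And>z. (\<And>u. u \<notin> F \<Longrightarrow> z u = 0) \<Longrightarrow> l * (\<Sum>u\<in>V. (z u)\<^sup>2) \<le> energy z"
  shows "dirichlet_eigen F y l"
proof -
  have "lap y w = l * y w" if "w \<in> F" for w
  proof -
    have "w \<in> V" using that F by blast
    define e :: "'a \<Rightarrow> real" where "e u = (if u = w then 1 else 0)" for u
    have "0 \<le> 2 * t * (lap y w - l * y w) + t\<^sup>2 * (energy e - l)" for t
    proof -
      have "(\<Sum>u\<in>V. (y u + t * e u)\<^sup>2)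
          = (\<Sum>u\<in>V. (y u)\<^sup>2 + 2 * t * (if u = w then y w else 0) + t\<^sup>2 * (if u = w then 1 else 0))"
        by (intro sum.cong) (auto simp: e_def power2_eq_square algebra_simps)
      also have "\<dots> = (\<Sum>u\<in>V. (y u)\<^sup>2) + 2 * t * y w + t\<^sup>2"
        using \<open>w \<in> V\<close> by (simp add: sum.distrib finite_V flip: sum_distrib_left)
      finally have sq: "(\<Sum>u\<in>V. (y u + t * e u)\<^sup>2) = (\<Sum>u\<in>V. (y u)\<^sup>2) + 2 * t * y w + t\<^sup>2" .
      have "(\<Sum>u\<in>V. e u * lap y u) = lap y w"
        using \<open>w \<in> V\<close> by (simp add: e_def finite_V if_distrib[of "\<lambda>x. x * _"] cong: if_cong)
      then have "energy (\<lambda>u. y u + t * e u) = energy y + 2 * t * lap y w + t\<^sup>2 * energy e"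
        by (simp add: energy_add_scaled)
      moreover have "l * (\<Sum>u\<in>V. (y u + t * e u)\<^sup>2) \<le> energy (\<lambda>u. y u + t * e u)"
        using supp that by (intro min) (auto simp: e_def)
      ultimately show ?thesis
        by (simp add: sq eq algebra_simps)
    qed
    then have "lap y w - l * y w = 0"
      by (rule perturbation_coefficient_zero)
    then show ?thesis by simp
  qed
  then show ?thesis
    using assms by (auto simp: dirichlet_eigen_def)
qed

text \<open>The absolute value of a minimizer has the same support and norm and no larger energy, so
  it is a minimizer too.\<close>

lemma nonneg_principal_eigen_exists:
  assumes "F \<subseteq> V" "F \<noteq> {}"
  obtains y l where "dirichlet_eigen F y l" "\<And>u. 0 \<le> y u"
    "\<And>z. (\<And>u. u \<notin> F \<Longrightarrow> z u = 0) \<Longrightarrow> l * (\<Sum>u\<in>V. (z u)\<^sup>2) \<le> energy z"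
proof -
  obtain y where supp: "\<And>u. u \<notin> F \<Longrightarrow> y u = 0" and nrm: "(\<Sum>u\<in>V. (y u)\<^sup>2) = 1"
    and min: "\<And>z. (\<And>u. u \<notin> F \<Longrightarrow> z u = 0) \<Longrightarrow> energy y * (\<Sum>u\<in>V. (z u)\<^sup>2) \<le> energy z"
    using energy_minimizer_exists[OF assms] by metis
  define x where "x u = \<bar>y u\<bar>" for u
  have "energy y \<le> energy x"
    using min[of x] supp by (simp add: x_def nrm)
  then have "energy x = energy y"
    using energy_abs_le[of y] by (simp add: x_def[abs_def])
  moreover have "\<exists>u. x u \<noteq> 0"
  proof (rule ccontr)
    assume "\<not> (\<exists>u. x u \<noteq> 0)"
    then have "y u = 0" for u by (simp add: x_def)
    then show False using nrm by simp
  qed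
  ultimately have "dirichlet_eigen F x (energy y)"
    using supp min by (intro minimizer_is_dirichlet_eigen[OF assms(1)]) (auto simp: x_def nrm)
  then show ?thesis
    using that[of x "energy y"] min by (auto simp: x_def)
qed

section \<open>Boundary flows and cuts\<close>

text \<open>Flows between two vertices of \<open>F\<close> cancel by antisymmetry; only the flow
  into the complement remains, and there \<open>y\<close> is 0.\<close>

lemma dirichlet_eigen_sum:
  assumes "dirichlet_eigen F y l" "F \<subseteq> V"
  shows "l * (\<Sum>u\<in>F. y u) = (\<Sum>u\<in>F. y u * (\<Sum>v\<in>V - F. a u v))"
proof -
  have "finite F" using assms finite_V finite_subset by blast
  have supp: "y v = 0" if "v \<in> V - F" for v
    using that assms by (auto simp: dirichlet_eigen_def)
  have "l * (\<Sum>u\<in>F. y u) = (\<Sum>u\<in>F. lap y u)"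
    using assms by (simp add: sum_distrib_left dirichlet_eigen_def)
  also have "\<dots> = (\<Sum>u\<in>F. (\<Sum>v\<in>V - F. a u v * (y u - y v)) + (\<Sum>v\<in>F. a u v * (y u - y v)))"
    unfolding lap_def by (intro sum.cong sum.subset_diff refl assms finite_V)
  also have "\<dots> = (\<Sum>u\<in>F. \<Sum>v\<in>V - F. a u v * (y u - y v)) + (\<Sum>u\<in>F. \<Sum>v\<in>F. a u v * (y u - y v))"
    by (rule sum.distrib)
  also have "(\<Sum>u\<in>F. \<Sum>v\<in>F. a u v * (y u - y v)) = 0"
    by (subst sum_symmetrize[OF \<open>finite F\<close>]) simp
  also have "(\<Sum>u\<in>F. \<Sum>v\<in>V - F. a u v * (y u - y v)) = (\<Sum>u\<in>F. y u * (\<Sum>v\<in>V - F. a u v))"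
    by (intro sum.cong refl) (simp add: sum_distrib_left supp mult.commute)
  finally show ?thesis by simp
qed

text \<open>Only edges leaving \<open>X\<close> see a nonzero difference, so the energy is the
  weight of the cut.\<close>

lemma energy_indicator:
  assumes "X \<subseteq> V"
  shows "energy (indicator X) = (\<Sum>u\<in>X. \<Sum>v\<in>V - X. a u v)"
proof -
  have "energy (indicator X) = (\<Sum>u\<in>X. lap (indicator X) u)"
    unfolding energy_eq_sum_lap using assms finite_V
    by (intro sum.mono_neutral_cong_right) (auto simp: indicator_def)
  also have "\<dots> = (\<Sum>u\<in>X. \<Sum>v\<in>V - X. a u v)"
    unfolding lap_def using finite_V
    by (intro sum.cong sum.mono_neutral_cong_right) (auto simp: indicator_def)
  finally show ?thesis .
qed

section \<open>Pointwise bounds in terms of distance\<close>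

text \<open>
  Confining the energy to the growing sets \<open>nbhd k r\<close> replaces the Cauchy-Schwarz estimate along a
  shortest path by an induction on \<open>r\<close>: a vertex that is new at radius \<open>r + 1\<close> contributes an
  edge not counted before.
\<close>

fun nbhd :: "'a \<Rightarrow> nat \<Rightarrow> 'a set" where
  "nbhd k 0 = {k}"
| "nbhd k (Suc r) = nbhd k r \<union> {v \<in> V. \<exists>u\<in>nbhd k r. 1 \<le> a v u}"

definition energy_on :: "'a set \<Rightarrow> ('a \<Rightarrow> real) \<Rightarrow> real" where
  "energy_on B y = (\<Sum>u\<in>B. \<Sum>v\<in>B. a u v * (y u - y v)\<^sup>2) / 2"

lemma nbhd_subset: "k \<in> V \<Longrightarrow> nbhd k r \<subseteq> V"
  by (induction r) auto

lemma energy_on_nonneg: "0 \<le> energy_on B y"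
  unfolding energy_on_def by (simp add: sum_nonneg weight_nonneg)

lemma energy_on_mono:
  assumes "B \<subseteq> C" "finite C"
  shows "energy_on B y \<le> energy_on C y"
proof -
  have "(\<Sum>u\<in>B. \<Sum>v\<in>B. a u v * (y u - y v)\<^sup>2) \<le> (\<Sum>u\<in>B. \<Sum>v\<in>C. a u v * (y u - y v)\<^sup>2)"
    using assms by (intro sum_mono sum_mono2) (auto simp: weight_nonneg)
  also have "\<dots> \<le> (\<Sum>u\<in>C. \<Sum>v\<in>C. a u v * (y u - y v)\<^sup>2)"
    using assms by (intro sum_mono2) (auto simp: weight_nonneg sum_nonneg)
  finally show ?thesis
    by (simp add: energy_on_def)
qed

text \<open>The edge between \<open>v\<close> and \<open>u\<close> occurs in both orientations among
  the new terms, which compensates the factor 1/2; the other new terms are non-negative.\<close>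

lemma energy_on_insert_ge:
  assumes "finite B" "v \<notin> B" "u \<in> B" "1 \<le> a v u"
  shows "energy_on B y + (y v - y u)\<^sup>2 \<le> energy_on (insert v B) y"
proof -
  have "1 * (y v - y u)\<^sup>2 \<le> a v u * (y v - y u)\<^sup>2"
    using assms by (intro mult_right_mono) auto
  also have "\<dots> \<le> (\<Sum>w\<in>B. a v w * (y v - y w)\<^sup>2)"
    using assms by (intro member_le_sum[of u B "\<lambda>w. a v w * (y v - y w)\<^sup>2"]) (auto simp: weight_nonneg)
  finally have "(y v - y u)\<^sup>2 \<le> (\<Sum>w\<in>B. a v w * (y v - y w)\<^sup>2)" by simp
  moreover have "(\<Sum>w\<in>B. a w v * (y w - y v)\<^sup>2) = (\<Sum>w\<in>B. a v w * (y v - y w)\<^sup>2)"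
    by (simp add: weight_sym power2_commute)
  ultimately show ?thesis
    using assms by (simp add: energy_on_def sum.distrib)
qed

lemma square_le_energy_on_nbhd:
  assumes "k \<in> V" "y k = 0"
  shows "v \<in> nbhd k r \<Longrightarrow> (y v)\<^sup>2 \<le> real r * energy_on (nbhd k r) y"
proof (induction r arbitrary: v)
  case 0
  then show ?case using assms by simp
next
  case (Suc r)
  let ?E = "energy_on (nbhd k r) y"
  have fin: "finite (nbhd k i)" for i
    using nbhd_subset[OF assms(1)] finite_V finite_subset by blast
  show ?case
  proof (cases "v \<in> nbhd k r")
    case True
    have "(y v)\<^sup>2 \<le> real r * ?E"
      using Suc.IH[OF True] .
    also have "\<dots> \<le> real (Suc r) * energy_on (nbhd k (Suc r)) y"
      by (intro mult_mono energy_on_mono fin) (auto simp: energy_on_nonneg)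
    finally show ?thesis .
  next
    case False
    then obtain u where u: "u \<in> nbhd k r" "1 \<le> a v u"
      using Suc.prems by auto
    define d where "d = y v - y u"
    have yv: "y v = y u + d"
      by (simp add: d_def)
    have yu: "(y u)\<^sup>2 \<le> real r * ?E"
      using Suc.IH[OF u(1)] .
    have "?E + d\<^sup>2 \<le> energy_on (insert v (nbhd k r)) y"
      unfolding d_def using False u fin by (intro energy_on_insert_ge)
    also have "\<dots> \<le> energy_on (nbhd k (Suc r)) y"
      using Suc.prems by (intro energy_on_mono fin) auto
    finally have grow: "?E + d\<^sup>2 \<le> energy_on (nbhd k (Suc r)) y" .
    have "(y v)\<^sup>2 \<le> (real r + 1) * (?E + d\<^sup>2)"
    \<comment> \<open>Radius 0 is separate because the main case cancels a factor \<open>r\<close>;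
      here \<open>y u\<close> must be 0.\<close>
    proof (cases "r = 0")
      case True
      then show ?thesis
        using yu energy_on_nonneg[of "nbhd k r" y] by (simp add: d_def)
    next
      case False
      \<comment> \<open>Completing the square gives a two-term Cauchy-Schwarz inequality, weighted
        so that \<open>r\<close> earlier edges and one new edge add up to the factor
        \<open>r + 1\<close>.\<close>
      have "real r * (y v)\<^sup>2 = (real r + 1) * ((y u)\<^sup>2 + real r * d\<^sup>2) - (y u - real r * d)\<^sup>2"
        by (simp add: yv power2_eq_square algebra_simps)
      also have "\<dots> \<le> (real r + 1) * ((y u)\<^sup>2 + real r * d\<^sup>2)"
        by simp
      also have "\<dots> \<le> (real r + 1) * (real r * ?E + real r * d\<^sup>2)"
        using yu by (intro mult_left_mono) auto
      also have "\<dots> = real r * ((real r + 1) * (?E + d\<^sup>2))"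
        by (simp add: algebra_simps)
      finally show ?thesis
        using False by simp
    qed
    also have "\<dots> \<le> real (Suc r) * energy_on (nbhd k (Suc r)) y"
      using grow by (simp add: add.commute mult_left_mono)
    finally show ?thesis .
  qed
qed

lemma square_le_energy_nbhd:
  assumes "k \<in> V" "y k = 0" "v \<in> nbhd k r"
  shows "(y v)\<^sup>2 \<le> real r * energy y"
proof -
  have "energy_on (nbhd k r) y \<le> energy y"
    using energy_on_mono[OF nbhd_subset finite_V] assms(1)
    by (simp add: energy_def energy_on_def)
  then show ?thesis
    using square_le_energy_on_nbhd[where y = y, OF assms]
    by (meson mult_left_mono of_nat_0_le_iff order_trans)
qed

end

section \<open>Simple graphs as networks with unit weights\<close>

definition edge_weight :: "('a, 'b) pre_digraph \<Rightarrow> 'a \<Rightarrow> 'a \<Rightarrow> real" where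
  "edge_weight G u v = (if u \<rightarrow>\<^bsub>G\<^esub> v then 1 else 0)"

lemma sum_edge_weight:
  "finite A \<Longrightarrow> (\<Sum>v\<in>A. edge_weight G u v) = real (card {v \<in> A. u \<rightarrow>\<^bsub>G\<^esub> v})"
  by (simp add: edge_weight_def sum.If_cases Collect_conj_eq Int_commute)

context graph
begin

sublocale net: network "verts G" "edge_weight G"
  using arcs_ends_symmetric[OF sym_arcs]
  by unfold_locales (auto simp: edge_weight_def)

lemma out_degree_eq_sum: "real (out_degree G u) = (\<Sum>v\<in>verts G. edge_weight G u v)"
proof -
  \<comment> \<open>Without parallel arcs an out-arc is determined by its head, so counting arcs
    counts neighbours.\<close>
  have "bij_betw (head G) (out_arcs G u) {v \<in> verts G. u \<rightarrow>\<^bsub>G\<^esub> v}"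
    unfolding bij_betw_def
    by (auto simp: inj_on_def arcs_ends_conv arc_to_ends_def intro: no_multi_arcs)
  then show ?thesis
    by (simp add: out_degree_def sum_edge_weight bij_betw_same_card)
qed

lemma leader_count_eq_sum:
  "S \<subseteq> verts G \<Longrightarrow> real (leader_count G S u) = (\<Sum>v\<in>S. edge_weight G u v)"
  by (simp add: leader_count_def sum_edge_weight finite_subset[OF _ finite_verts])

text \<open>Each boundary edge has exactly one endpoint in \<open>X\<close>; listing it first
  identifies edges with ordered pairs.\<close>

lemma card_edge_boundary_eq_sum:
  assumes "X \<subseteq> verts G"
  shows "real (card (edge_boundary G X)) = (\<Sum>u\<in>X. \<Sum>v\<in>verts G - X. edge_weight G u v)"
proof -
  have fin: "finite X"
    using assms finite_verts by (rule finite_subset)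
  let ?P = "SIGMA u:X. {v \<in> verts G - X. u \<rightarrow>\<^bsub>G\<^esub> v}"
  have "edge_boundary G X = (\<lambda>(u, v). {u, v}) ` ?P"
    by (auto simp: edge_boundary_def)
  moreover have "inj_on (\<lambda>(u, v). {u, v}) ?P"
    by (auto simp: inj_on_def doubleton_eq_iff)
  ultimately have "card (edge_boundary G X) = card ?P"
    by (simp add: card_image)
  also have "\<dots> = (\<Sum>u\<in>X. card {v \<in> verts G - X. u \<rightarrow>\<^bsub>G\<^esub> v})"
    using fin by (simp add: card_SigmaI)
  finally show ?thesis
    by (simp add: sum_edge_weight)
qed

text \<open>Every arc has its reverse. This lets the boundary of the leaders be counted from the
  followers.\<close>

lemma edge_boundary_compl:
  assumes "X \<subseteq> verts G"
  shows "edge_boundary G (verts G - X) = edge_boundary G X"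
proof -
  have compl: "edge_boundary G Y \<subseteq> edge_boundary G (verts G - Y)" if "Y \<subseteq> verts G" for Y
  proof
    fix e
    assume "e \<in> edge_boundary G Y"
    then obtain u v where e: "e = {v, u}" "u \<in> Y" "v \<in> verts G - Y" "u \<rightarrow>\<^bsub>G\<^esub> v"
      unfolding edge_boundary_def by (auto simp: insert_commute)
    moreover have "v \<rightarrow>\<^bsub>G\<^esub> u"
      using arcs_ends_symmetric[OF sym_arcs e(4)] .
    ultimately show "e \<in> edge_boundary G (verts G - Y)"
      using that unfolding edge_boundary_def by blast
  qed
  show ?thesis
    using compl[OF assms] compl[OF Diff_subset, of X] assms by (simp add: double_diff)
qed

section \<open>Distances and the closeness bound\<close>

text \<open>Removing the first arc leaves a shorter walk to \<open>k\<close>, which matches the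
  recursion of \<open>nbhd\<close> and the direction of the distance in
  \<open>closeness_centrality\<close>.\<close>

lemma awalk_imp_nbhd: "awalk v p k \<Longrightarrow> v \<in> net.nbhd k (length p)"
proof (induction p arbitrary: v)
  case Nil
  then show ?case by (simp add: awalk_Nil_iff)
next
  case (Cons e p)
  then have e: "e \<in> arcs G" "tail G e = v" "awalk (head G e) p k"
    by (auto simp: awalk_Cons_iff)
  then have "1 \<le> edge_weight G v (head G e)"
    by (auto simp: edge_weight_def arcs_ends_conv)
  then show ?case
    using Cons.IH[OF e(3)] e by auto
qed

text \<open>Connectedness gives a path attaining the distance; with unit costs its cost is its
  length, which serves as the radius.\<close>

lemma distance_imp_nbhd:
  assumes "Digraph_Component.connected G" "k \<in> verts G" "v \<in> verts G"
  obtains r where "v \<in> net.nbhd k r" "real_of_ereal (\<mu> (\<lambda>_. 1) v k) = real r"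
proof -
  have "v \<rightarrow>\<^sup>* k"
    using assms reachable_mk_symmetric_eq[OF sym_arcs]
    by (auto simp: Digraph_Component.connected_def)
  then obtain p where p: "apath v p k" "\<mu> (\<lambda>_. 1) v k = awalk_cost (\<lambda>_. 1) p"
    using min_cost_awalk[of v k "\<lambda>_. 1"] by auto
  have "awalk_cost (\<lambda>_. 1) p = length p"
    by (induction p) auto
  then show ?thesis
    using p that[of "length p"] by (auto simp: apath_def intro: awalk_imp_nbhd)
qed

lemma inverse_closeness_le_eigenvalue:
  assumes conn: "Digraph_Component.connected G" and k: "k \<in> verts G - F" and F: "F \<subseteq> verts G"
    and eig: "net.dirichlet_eigen F y l"
  shows "1 / closeness_centrality G k \<le> l"
proof -
  have "y k = 0"
    using eig k by (auto simp: net.dirichlet_eigen_def)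
  have "(y v)\<^sup>2 \<le> real_of_ereal (\<mu> (\<lambda>_. 1) v k) * net.energy y" if "v \<in> verts G" for v
    using that k \<open>y k = 0\<close>
    by (elim distance_imp_nbhd[OF conn, rotated]) (auto intro: net.square_le_energy_nbhd)
  then have "(\<Sum>v\<in>verts G. (y v)\<^sup>2) \<le> closeness_centrality G k * net.energy y"
    unfolding closeness_centrality_def sum_distrib_right by (rule sum_mono)
  also have "\<dots> = (closeness_centrality G k * l) * (\<Sum>v\<in>verts G. (y v)\<^sup>2)"
    by (simp add: net.dirichlet_eigen_energy[OF eig])
  finally have "1 \<le> closeness_centrality G k * l"
    using net.dirichlet_eigen_sum_squares_pos[OF eig F] by simp
  moreover have "0 \<le> l"
    using net.dirichlet_eigen_nonneg[OF eig F] .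
  \<comment> \<open>A non-positive closeness times the non-negative \<open>l\<close> could not reach
    1.\<close>
  ultimately have "0 < closeness_centrality G k"
    by (smt (verit) mult_nonpos_nonneg)
  then show ?thesis
    using \<open>1 \<le> closeness_centrality G k * l\<close> by (simp add: divide_le_eq mult.commute)
qed

end

section \<open>Follower vectors as functions on the vertices\<close>

text \<open>\<open>pick F\<close> is the enumeration used by \<open>submatrix\<close>. Counting the
  smaller elements of \<open>F\<close> inverts it, and surjectivity follows by cardinality.\<close>

lemma bij_betw_pick:
  assumes "finite F"
  shows "bij_betw (pick F) {..<card F} F"
proof -
  have "inj_on (pick F) {..<card F}"
    by (rule inj_on_inverseI[of _ "\<lambda>v. card {a \<in> F. a < v}"]) (simp add: card_pick_le)
  moreover have "pick F ` {..<card F} \<subseteq> F"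
    by (auto intro: pick_in_set_le)
  ultimately show ?thesis
    using assms by (metis bij_betw_def card_image card_lessThan card_subset_eq)
qed

text \<open>The index is the rank of \<open>v\<close> in \<open>F\<close>, the inverse of
  \<open>pick F\<close>.\<close>

definition extend_by_zero :: "nat set \<Rightarrow> real vec \<Rightarrow> nat \<Rightarrow> real" where
  "extend_by_zero F x v = (if v \<in> F then x $ card {a \<in> F. a < v} else 0)"

lemma extend_by_zero_pick: "i < card F \<Longrightarrow> extend_by_zero F x (pick F i) = x $ i"
  by (simp add: extend_by_zero_def card_pick_le pick_in_set_le)

lemma image_extend_by_zero:
  assumes "finite F" "dim_vec x = card F"
  shows "extend_by_zero F x ` F = set\<^sub>v x"
proof -
  have "extend_by_zero F x ` F = extend_by_zero F x ` pick F ` {..<card F}"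
    using bij_betw_pick[OF assms(1)] by (simp add: bij_betw_def)
  also have "\<dots> = set\<^sub>v x"
    using assms by (force simp: vec_set_def image_image extend_by_zero_pick)
  finally show ?thesis .
qed

lemma extend_by_zero_surj:
  assumes "finite F" "\<And>v. v \<notin> F \<Longrightarrow> y v = 0"
  shows "extend_by_zero F (vec (card F) (\<lambda>i. y (pick F i))) = y"
proof
  fix v
  show "extend_by_zero F (vec (card F) (\<lambda>i. y (pick F i))) v = y v"
  proof (cases "v \<in> F")
    case True
    then have "card {a \<in> F. a < v} < card F"
      using assms(1) by (intro psubset_card_mono) auto
    then show ?thesis
      using True by (simp add: extend_by_zero_def pick_card_in_set)
  qed (simp add: assms extend_by_zero_def)
qed

section \<open>The grounded Laplacian as a Dirichlet operator\<close>

locale grounded_graph = graph G for G :: "(nat, 'b) pre_digraph" +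
  fixes S :: "nat set" and n :: nat
  assumes verts_eq: "verts G = {0..<n}"
    and S_subset: "S \<subseteq> verts G"
    and followers_nonempty: "verts G - S \<noteq> {}"
begin

abbreviation "F \<equiv> verts G - S"

lemma finite_F: "finite F"
  by simp

lemma dim_laplacian: "dim_row (laplacian G) = n" "dim_col (laplacian G) = n"
  by (simp_all add: laplacian_def degree_matrix_def adjacency_matrix_def verts_eq)

lemma index_set_F: "{i. i < n \<and> i \<in> F} = F"
  unfolding verts_eq by auto

lemma grounded_laplacian_carrier: "grounded_laplacian G S \<in> carrier_mat (card F) (card F)"
  by (rule carrier_matI) (simp_all only: grounded_laplacian_def dim_submatrix dim_laplacian index_set_F)

lemma grounded_laplacian_index:
  assumes "i < card F" "j < card F"
  shows "grounded_laplacian G S $$ (i, j) = laplacian G $$ (pick F i, pick F j)"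
  unfolding grounded_laplacian_def
  by (rule submatrix_index) (simp_all only: dim_laplacian index_set_F assms)

lemma laplacian_index:
  assumes "u \<in> verts G" "v \<in> verts G"
  shows "laplacian G $$ (u, v) = (if u = v then real (out_degree G u) else 0) - edge_weight G u v"
  using assms
  by (simp add: laplacian_def degree_matrix_def adjacency_matrix_def edge_weight_def verts_eq)

text \<open>Deleting the leader columns has the same effect as multiplying them by 0, so the product
  is the full Laplacian applied to the extension by zero, read off at the followers.\<close>

lemma grounded_laplacian_mult:
  assumes "x \<in> carrier_vec (card F)" "i < card F"
  shows "(grounded_laplacian G S *\<^sub>v x) $ i = net.lap (extend_by_zero F x) (pick F i)"
proof -
  let ?y = "extend_by_zero F x" and ?u = "pick F i"
  have u: "?u \<in> F"
    using assms by (intro pick_in_set_le)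
  have "(grounded_laplacian G S *\<^sub>v x) $ i
      = (\<Sum>j<card F. grounded_laplacian G S $$ (i, j) * x $ j)"
    using assms grounded_laplacian_carrier
    by (simp add: scalar_prod_def lessThan_atLeast0)
  also have "\<dots> = (\<Sum>j<card F. laplacian G $$ (?u, pick F j) * ?y (pick F j))"
    using assms by (intro sum.cong) (auto simp: grounded_laplacian_index extend_by_zero_pick)
  also have "\<dots> = (\<Sum>v\<in>F. laplacian G $$ (?u, v) * ?y v)"
    by (rule sum.reindex_bij_betw[OF bij_betw_pick[OF finite_F]])
  also have "\<dots> = (\<Sum>v\<in>verts G. laplacian G $$ (?u, v) * ?y v)"
    by (intro sum.mono_neutral_left) (auto simp: extend_by_zero_def)
  also have "\<dots> = (\<Sum>v\<in>verts G. (if v = ?u then real (out_degree G ?u) * ?y v else 0)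
      - edge_weight G ?u v * ?y v)"
    using u by (intro sum.cong) (auto simp: laplacian_index algebra_simps)
  also have "\<dots> = real (out_degree G ?u) * ?y ?u - (\<Sum>v\<in>verts G. edge_weight G ?u v * ?y v)"
    using u by (simp add: sum_subtractf)
  also have "\<dots> = net.lap ?y ?u"
    by (simp add: out_degree_eq_sum net.lap_def sum_distrib_right right_diff_distrib sum_subtractf)
  finally show ?thesis .
qed

lemma eigenvector_iff_dirichlet_eigen:
  assumes x: "x \<in> carrier_vec (card F)"
  shows "eigenvector (grounded_laplacian G S) x l \<longleftrightarrow> net.dirichlet_eigen F (extend_by_zero F x) l"
proof -
  let ?y = "extend_by_zero F x"
  have onF: "(\<forall>u\<in>F. P u) \<longleftrightarrow> (\<forall>i<card F. P (pick F i))" for P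
  proof -
    have "(\<forall>u\<in>pick F ` {..<card F}. P u) \<longleftrightarrow> (\<forall>i<card F. P (pick F i))"
      by auto
    then show ?thesis
      using bij_betw_pick[OF finite_F] by (simp only: bij_betw_def)
  qed
  have dim: "dim_row (grounded_laplacian G S) = card F"
    using grounded_laplacian_carrier by blast
  have "x = 0\<^sub>v (card F) \<longleftrightarrow> (\<forall>u\<in>F. ?y u = 0)"
    using x unfolding onF by (auto simp: vec_eq_iff extend_by_zero_pick)
  also have "\<dots> \<longleftrightarrow> \<not> (\<exists>u. ?y u \<noteq> 0)"
    by (auto simp: extend_by_zero_def)
  finally have zero: "x = 0\<^sub>v (card F) \<longleftrightarrow> \<not> (\<exists>u. ?y u \<noteq> 0)" .
  have "grounded_laplacian G S *\<^sub>v x = l \<cdot>\<^sub>v x \<longleftrightarrow>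
      (\<forall>i<card F. (grounded_laplacian G S *\<^sub>v x) $ i = (l \<cdot>\<^sub>v x) $ i)"
    using x dim by (subst vec_eq_iff) auto
  also have "\<dots> \<longleftrightarrow> (\<forall>u\<in>F. net.lap ?y u = l * ?y u)"
    using x unfolding onF by (simp add: grounded_laplacian_mult extend_by_zero_pick)
  finally show ?thesis
    using x zero by (auto simp: eigenvector_def net.dirichlet_eigen_def dim extend_by_zero_def)
qed

lemma eigenvalue_iff_dirichlet_eigen:
  "eigenvalue (grounded_laplacian G S) l \<longleftrightarrow> (\<exists>y. net.dirichlet_eigen F y l)"
proof
  assume "eigenvalue (grounded_laplacian G S) l"
  then obtain x where "eigenvector (grounded_laplacian G S) x l"
    by (auto simp: eigenvalue_def)
  moreover from this have "x \<in> carrier_vec (card F)"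
    using grounded_laplacian_carrier by (auto simp: eigenvector_def)
  ultimately show "\<exists>y. net.dirichlet_eigen F y l"
    using eigenvector_iff_dirichlet_eigen by blast
next
  assume "\<exists>y. net.dirichlet_eigen F y l"
  then obtain y where y: "net.dirichlet_eigen F y l" ..
  define x where "x = vec (card F) (\<lambda>i. y (pick F i))"
  have "extend_by_zero F x = y"
    unfolding x_def using y by (intro extend_by_zero_surj finite_F) (auto simp: net.dirichlet_eigen_def)
  then have "eigenvector (grounded_laplacian G S) x l"
    using y by (subst eigenvector_iff_dirichlet_eigen) (auto simp: x_def)
  then show "eigenvalue (grounded_laplacian G S) l"
    by (auto simp: eigenvalue_def)
qed

section \<open>The smallest eigenvalue and its non-negative eigenvectors\<close>

abbreviation "l1 \<equiv> smallest_eigenvalue (grounded_laplacian G S)"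

text \<open>The minimal Rayleigh value is itself an eigenvalue, and every eigenvalue is the Rayleigh
  quotient of its eigenfunction, so it is the minimum of the finite spectrum.\<close>

lemma smallest_eigenvalue_nonneg_eigen: "\<exists>y. net.dirichlet_eigen F y l1 \<and> (\<forall>u. 0 \<le> y u)"
  and smallest_eigenvalue_le_rayleigh:
    "(\<And>u. u \<notin> F \<Longrightarrow> z u = 0) \<Longrightarrow> l1 * (\<Sum>u\<in>verts G. (z u)\<^sup>2) \<le> net.energy z"
proof -
  obtain y l where y: "net.dirichlet_eigen F y l" "\<And>u. 0 \<le> y u"
    and min: "\<And>z. (\<And>u. u \<notin> F \<Longrightarrow> z u = 0) \<Longrightarrow> l * (\<Sum>u\<in>verts G. (z u)\<^sup>2) \<le> net.energy z"
    using net.nonneg_principal_eigen_exists[OF Diff_subset followers_nonempty] by metis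
  have "l1 = l"
    unfolding smallest_eigenvalue_def
  proof (rule Min_eqI)
    show "finite (spectrum (grounded_laplacian G S))"
      by (rule card_finite_spectrum(1)[OF grounded_laplacian_carrier])
    show "l \<in> spectrum (grounded_laplacian G S)"
      using y by (auto simp: spectrum_def eigenvalue_iff_dirichlet_eigen)
    fix m
    assume "m \<in> spectrum (grounded_laplacian G S)"
    then obtain z where z: "net.dirichlet_eigen F z m"
      by (auto simp: spectrum_def eigenvalue_iff_dirichlet_eigen)
    then have "l * (\<Sum>u\<in>verts G. (z u)\<^sup>2) \<le> m * (\<Sum>u\<in>verts G. (z u)\<^sup>2)"
      using min[of z] net.dirichlet_eigen_energy[OF z] by (auto simp: net.dirichlet_eigen_def)
    then show "l \<le> m"
      using net.dirichlet_eigen_sum_squares_pos[OF z] by simp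
  qed
  then show "\<exists>y. net.dirichlet_eigen F y l1 \<and> (\<forall>u. 0 \<le> y u)"
    using y by blast
  show "l1 * (\<Sum>u\<in>verts G. (z u)\<^sup>2) \<le> net.energy z" if "\<And>u. u \<notin> F \<Longrightarrow> z u = 0"
    unfolding \<open>l1 = l\<close> using that by (rule min)
qed

text \<open>This keeps the quantification over eigenvectors in the theorem from being vacuous. The
  eigenfunction is divided by its largest value on \<open>F\<close>, positive since it is
  non-negative and nonzero.\<close>

lemma normalized_nonneg_eigenvector_exists:
  "\<exists>x. normalized_nonneg_eigenvector (grounded_laplacian G S) l1 x"
proof -
  obtain y where y: "net.dirichlet_eigen F y l1" "\<And>u. 0 \<le> y u"
    using smallest_eigenvalue_nonneg_eigen by blast
  define M where "M = Max (y ` F)"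
  have "M \<in> y ` F"
    unfolding M_def using finite_F followers_nonempty by (intro Max_in) auto
  then obtain w where w: "w \<in> F" "y w = M"
    by blast
  have le: "y u \<le> M" if "u \<in> F" for u
    using that by (simp add: M_def)
  obtain u where "u \<in> F" "y u \<noteq> 0"
    using y(1) by (auto simp: net.dirichlet_eigen_def)
  then have "0 < M"
    using y(2)[of u] le[of u] by simp
  define x where "x = vec (card F) (\<lambda>i. y (pick F i) / M)"
  have ext: "extend_by_zero F x = (\<lambda>u. y u / M)"
    unfolding x_def using y
    by (intro extend_by_zero_surj[where y = "\<lambda>u. y u / M"] finite_F)
       (auto simp: net.dirichlet_eigen_def)
  have "net.lap (\<lambda>u. y u / M) u = net.lap y u / M" for u
    by (simp add: net.lap_def sum_divide_distrib flip: diff_divide_distrib)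
  then have "net.dirichlet_eigen F (\<lambda>u. y u / M) l1"
    using y \<open>0 < M\<close> by (auto simp: net.dirichlet_eigen_def)
  then have "eigenvector (grounded_laplacian G S) x l1"
    by (subst eigenvector_iff_dirichlet_eigen) (simp_all add: ext, simp add: x_def)
  moreover have set_x: "set\<^sub>v x = (\<lambda>u. y u / M) ` F"
    using image_extend_by_zero[OF finite_F, of x] by (simp add: ext, simp add: x_def)
  moreover have "Max (set\<^sub>v x) = 1"
    unfolding set_x using w le \<open>0 < M\<close>
    by (intro Max_eqI) (auto intro!: image_eqI[of _ _ w])
  moreover have "\<forall>a\<in>set\<^sub>v x. 0 \<le> a"
    unfolding set_x using y(2) \<open>0 < M\<close> by simp
  ultimately show ?thesis
    unfolding normalized_nonneg_eigenvector_def by (intro exI[of _ x] conjI)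
qed

section \<open>Bounds by leader counts and edge boundaries\<close>

lemma card_F: "real n - real (card S) = real (card F)"
proof -
  have "card F + card S = n"
    using card_Diff_subset[OF finite_subset[OF S_subset finite_verts] S_subset]
      card_mono[OF finite_verts S_subset] by (simp add: verts_eq)
  then show ?thesis by linarith
qed

lemma card_F_pos: "0 < card F"
  using followers_nonempty by (simp add: card_gt_0_iff)

lemma verts_diff_F: "verts G - F = S"
  using S_subset by blast

lemma card_boundary_leaders:
  "real (card (edge_boundary G S)) = (\<Sum>u\<in>F. real (leader_count G S u))"
  using card_edge_boundary_eq_sum[OF Diff_subset, of S]
  by (simp only: edge_boundary_compl[OF S_subset] verts_diff_F leader_count_eq_sum[OF S_subset])

lemma smallest_eigenvalue_le_boundary_ratio:
  assumes "X \<noteq> {}" "X \<subseteq> F"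
  shows "l1 \<le> real (card (edge_boundary G X)) / real (card X)"
proof -
  have X: "X \<subseteq> verts G" "finite X"
    using assms(2) finite_subset[OF assms(2) finite_F] by auto
  have "l1 * (\<Sum>u\<in>verts G. (indicator X u)\<^sup>2) \<le> net.energy (indicator X)"
    using assms by (intro smallest_eigenvalue_le_rayleigh) (auto simp: indicator_def)
  moreover have "(\<Sum>u\<in>verts G. (indicator X u)\<^sup>2) = (\<Sum>u\<in>X. 1 :: real)"
    using X(1) by (intro sum.mono_neutral_cong_right) (auto simp: indicator_def)
  ultimately show ?thesis
    using assms X
    by (simp add: net.energy_indicator card_edge_boundary_eq_sum le_divide_eq card_gt_0_iff)
qed

context
  fixes x :: "real vec"
  assumes x: "normalized_nonneg_eigenvector (grounded_laplacian G S) l1 x"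
begin

abbreviation "y \<equiv> extend_by_zero F x"

lemma x_carrier: "x \<in> carrier_vec (card F)"
proof -
  have "x \<in> carrier_vec (dim_row (grounded_laplacian G S))"
    using x unfolding normalized_nonneg_eigenvector_def eigenvector_def by (elim conjE)
  then show ?thesis
    by (simp only: carrier_matD(1)[OF grounded_laplacian_carrier])
qed

lemma y_eigen: "net.dirichlet_eigen F y l1"
  using x eigenvector_iff_dirichlet_eigen[OF x_carrier]
  by (simp add: normalized_nonneg_eigenvector_def)

lemma image_y: "set\<^sub>v x = y ` F"
  using image_extend_by_zero[OF finite_F, of x] x_carrier by simp

lemma y_bounds:
  assumes "u \<in> F"
  shows "0 \<le> y u" "y u \<le> 1" "Min (set\<^sub>v x) \<le> y u"
proof -
  have "y u \<in> set\<^sub>v x" "finite (set\<^sub>v x)"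
    using assms by (simp_all add: image_y)
  then show "0 \<le> y u" "y u \<le> 1" "Min (set\<^sub>v x) \<le> y u"
    using x Max_ge[of "set\<^sub>v x" "y u"] by (auto simp: normalized_nonneg_eigenvector_def)
qed

lemma sum_y_pos: "0 < (\<Sum>u\<in>F. y u)"
proof -
  have "Max (y ` F) = 1"
    using x by (simp add: normalized_nonneg_eigenvector_def image_y)
  then have "1 \<in> y ` F"
    using Max_in[of "y ` F"] followers_nonempty by simp
  then obtain u where "u \<in> F" "y u = 1"
    by auto
  then show ?thesis
    by (intro sum_pos2[of _ u]) (auto intro: y_bounds)
qed

lemma leader_weighted_sum: "l1 * (\<Sum>u\<in>F. y u) = (\<Sum>u\<in>F. y u * real (leader_count G S u))"
  using net.dirichlet_eigen_sum[OF y_eigen Diff_subset]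
  by (simp only: verts_diff_F leader_count_eq_sum[OF S_subset])

lemma leader_count_min_le: "real (leader_count_min G S) \<le> l1"
proof -
  have "real (leader_count_min G S) * (\<Sum>u\<in>F. y u) \<le> l1 * (\<Sum>u\<in>F. y u)"
    unfolding leader_weighted_sum unfolding sum_distrib_left
  proof (rule sum_mono)
    fix u
    assume u: "u \<in> F"
    then have "real (leader_count_min G S) \<le> real (leader_count G S u)"
      by (simp add: leader_count_min_def)
    from mult_right_mono[OF this y_bounds(1)[OF u]]
    show "real (leader_count_min G S) * y u \<le> y u * real (leader_count G S u)"
      by (simp only: mult.commute)
  qed
  then show ?thesis
    using sum_y_pos by simp
qed

text \<open>Both ends of the range of \<open>y\<close> enter: the minimum bounds the leader-weighted
  sum from below, and the maximum 1 bounds the sum of \<open>y\<close> by the number of followers,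
  using that \<open>l1\<close> is non-negative.\<close>

lemma boundary_times_min_le:
  "real (card (edge_boundary G S)) / real (card F) * Min (set\<^sub>v x) \<le> l1"
proof -
  have "real (card (edge_boundary G S)) * Min (set\<^sub>v x)
      \<le> (\<Sum>u\<in>F. y u * real (leader_count G S u))"
    unfolding card_boundary_leaders sum_distrib_right
    by (intro sum_mono, subst mult.commute, intro mult_right_mono y_bounds(3)) auto
  also have "\<dots> = l1 * (\<Sum>u\<in>F. y u)"
    by (simp add: leader_weighted_sum)
  also have "\<dots> \<le> l1 * real (card F)"
    using sum_bounded_above[of F y 1] y_bounds(2) net.dirichlet_eigen_nonneg[OF y_eigen]
    by (intro mult_left_mono) auto
  finally show ?thesis
    using card_F_pos by (simp add: divide_le_eq)
qed

end

text \<open>The ratio is the average of the leader counts over the followers.\<close>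

lemma boundary_ratio_le_leader_count_max:
  "real (card (edge_boundary G S)) / real (card F) \<le> real (leader_count_max G S)"
proof -
  have "(\<Sum>u\<in>F. real (leader_count G S u)) \<le> real (card F) * real (leader_count_max G S)"
    by (intro sum_bounded_above) (simp add: leader_count_max_def)
  then show ?thesis
    using card_F_pos by (simp add: card_boundary_leaders divide_le_eq mult.commute)
qed

end

theorem theorem2:
  fixes G :: "(nat, 'b) pre_digraph" and S :: "nat set" and n k :: nat
  assumes "graph G"
    and "Digraph_Component.connected G"
    and "verts G = {0..<n}"
    and "S \<subseteq> verts G"
    and "S \<noteq> {}"
    and "verts G - S \<noteq> {}"
    and "k \<in> S"
  shows "let L = grounded_laplacian G S; l1 = smallest_eigenvalue L in
    (\<exists>x. normalized_nonneg_eigenvector L l1 x) \<and>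
    (\<forall>x. normalized_nonneg_eigenvector L l1 x \<longrightarrow>
      Max {1 / closeness_centrality G k,
           real (leader_count_min G S),
           real (card (edge_boundary G S)) / (real n - real (card S)) * Min (set\<^sub>v x)} \<le> l1 \<and>
      l1 \<le> Min ((\<lambda>X. real (card (edge_boundary G X)) / real (card X))
                  ` {X. X \<noteq> {} \<and> X \<subseteq> verts G - S}) \<and>
      Min ((\<lambda>X. real (card (edge_boundary G X)) / real (card X))
             ` {X. X \<noteq> {} \<and> X \<subseteq> verts G - S})
        \<le> real (card (edge_boundary G S)) / (real n - real (card S)) \<and>
      real (card (edge_boundary G S)) / (real n - real (card S)) \<le> real (leader_count_max G S))"
proof -
  interpret graph G by fact
  interpret grounded_graph G S n
    using assms by unfold_locales auto
  let ?ratio = "\<lambda>X. real (card (edge_boundary G X)) / real (card X)"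
  let ?A = "{X. X \<noteq> {} \<and> X \<subseteq> F}"
  have fin: "finite (?ratio ` ?A)"
    by simp
  have F_in: "?ratio F \<in> ?ratio ` ?A"
    using followers_nonempty by blast
  \<comment> \<open>The follower set is itself a candidate in the minimum, and its boundary is that
    of the leaders.\<close>
  have "?ratio F = real (card (edge_boundary G S)) / real (card F)"
    by (simp only: edge_boundary_compl[OF S_subset])
  then have upper: "Min (?ratio ` ?A) \<le> real (card (edge_boundary G S)) / real (card F)"
    using Min_le[OF fin F_in] by (simp only:)
  have "l1 \<le> Min (?ratio ` ?A)"
    using fin F_in smallest_eigenvalue_le_boundary_ratio by (subst Min_ge_iff) auto
  \<comment> \<open>The eigenfunction obtained from the given \<open>x\<close> vanishes at the
    leader \<open>k\<close>, so it serves for the closeness bound as well.\<close>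
  moreover have "Max {1 / closeness_centrality G k, real (leader_count_min G S),
      real (card (edge_boundary G S)) / real (card F) * Min (set\<^sub>v x)} \<le> l1"
    if x: "normalized_nonneg_eigenvector (grounded_laplacian G S) l1 x" for x
    using inverse_closeness_le_eigenvalue[OF assms(2) _ Diff_subset y_eigen[OF x], of k]
      leader_count_min_le[OF x] boundary_times_min_le[OF x] assms
    by auto
  ultimately show ?thesis
    unfolding Let_def card_F
    using normalized_nonneg_eigenvector_exists upper boundary_ratio_le_leader_count_max
    by blast
qed

end
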